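(* Let $\mathbb{S}$ denote the set of $T$-odd matrix polynomials in $\mathbb{P}_m(\mathbb{C}^{n\times n})$. Let $P\in\mathbb{S}$ be regular and let $(\lambda,x)\in\mathbb{C}\times\mathbb{C}^n$ be such that $x^Hx=1$. Set $r:=-P(\lambda)x$, $P_x:=I-xx^H$ and $\Lambda_m:=[1,\lambda,\ldots,\lambda^m]^T$. Then $$\eta_F^{\mathbb{S}}(\lambda,x,P)=\begin{cases}\sqrt{\dfrac{|x^Tr|^2}{\|(I-\Pi_e)(\Lambda_m)\|_2^2}+2\,\dfrac{\|r\|_2^2-|x^Tr|^2}{\|\Lambda_m\|_2^2}},&\lambda\ne0,\\ \sqrt2\,\eta(\lambda,x,P),&\lambda=0,\end{cases}$$ $$\eta_2^{\mathbb{S}}(\lambda,x,P)=\begin{cases}\sqrt{\dfrac{|x^Tr|^2}{\|(I-\Pi_e)(\Lambda_m)\|_2^2}+\dfrac{\|r\|_2^2-|x^Tr|^2}{\|\Lambda_m\|_2^2}},&\lambda\ne0,\\ \eta(\lambda,x,P),&\lambda=0.\end{cases}$$ In particular, if $m$ is odd and $|\lambda|=1$, then $\eta_F^{\mathbb{S}}(\lambda,x,P)=\sqrt2\,\eta(\lambda,x,P)$ and $\eta_2^{\mathbb{S}}(\lambda,x,P)=\eta(\lambda,x,P)$. For $j=0,\ldots,m$ define $$F_j:=\begin{cases}\dfrac{\overline{\lambda^j}}{\|\Lambda_m\|_2^2}\left[P_x^Trx^H-\overline{x}r^TP_x\right],& j\text{ even},\\[2mm] \dfrac{\overline{\lambda^j}\,\overline{x}x^Trx^H}{\|(I-\Pi_e)(\Lambda_m)\|_2^2}+\dfrac{\overline{\lambda^j}}{\|\Lambda_m\|_2^2}\left[\overline{x}r^TP_x+P_x^Trx^H\right],&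 j\text{ odd}.\end{cases}$$ Then $\Delta P(z):=\sum_{j=0}^m z^jF_j$ is a unique $T$-odd polynomial in $\mathbb{S}$ such that $P(\lambda)x+\Delta P(\lambda)x=0$ and $|||\Delta P|||_F=\eta_F^{\mathbb{S}}(\lambda,x,P)$. Further, for $j=0,\ldots,m$ define $\Delta A_j:=F_j$ when $j$ is even and $$\Delta A_j:=F_j-\frac{\overline{\lambda^j}\;\overline{x^Tr}\;P_x^Trr^TP_x}{\|(I-\Pi_e)(\Lambda_m)\|_2^2\,(\|r\|_2^2-|x^Tr|^2)}$$ when $j$ is odd. Then $\Delta P(z):=\sum_{j=0}^m z^j\Delta A_j$ is a $T$-odd polynomial in $\mathbb{S}$ such that $P(\lambda)x+\Delta P(\lambda)x=0$ and $|||\Delta P|||_2=\eta_2^{\mathbb{S}}(\lambda,x,P)$. Here, for $\lambda=0$, all terms with denominator containing $\|(I-\Pi_e)(\Lambda_m)\|_2^2$ are taken to be $0$, and the term with denominator containing $\|r\|_2^2-|x^Tr|^2$ is taken to be $0$ if $|x^Tr|=\|r\|_2$.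
   Context: $m,n\ge1$ are integers. $\mathbb{P}_m(\mathbb{C}^{n\times n})$ is the vector space of matrix polynomials $P(z)=\sum_{j=0}^m z^jA_j$ with $A_j\in\mathbb{C}^{n\times n}$ (degree at most $m$). $P$ is regular if $\det P(z)\ne0$ for some $z\in\mathbb{C}$. $P$ is $T$-odd if $P(z)^T=-P(-z)$ for all $z$, i.e. $A_j$ is skew-symmetric for $j$ even (including $j=0$) and symmetric for $j$ odd. $\Pi_e:\mathbb{C}^{m+1}\to\mathbb{C}^{m+1}$ is the even index projection: it maps $[x_0,x_1,\ldots,x_m]^T$ to the vector obtained by replacing $x_j$ by $0$ for every odd $j$ and keeping $x_j$ for every even $j$; $I-\Pi_e$ is the odd index projection. Bars denote entrywise complex conjugation. For $M\in\{2,F\}$, $|||P|||_M:=\left(\sum_{j=0}^m\|A_j\|_M^2\right)^{1/2}$, where for matrices $\|\cdot\|_F$ is the Frobenius norm and $\|\cdot\|_2$ the spectral norm. For $P$ regular, $\lambda\in\mathbb{C}$ and $x\in\mathbb{C}^n$ with $x^Hx=1$, the unstructured backward error is $\eta(\lambda,x,P):=\inf\{|||\Delta P|||_M:\Delta P\in\mathbb{P}_m(\mathbb{C}^{n\times n}),\ P(\lambda)x+\Delta P(\lambda)x=0\}$, which equals $\|P(\lambda)x\|_2/\|\Lambda_m\|_2$ for both $M=2$ and $M=F$. For $P\in\mathbb{S}$ the structured backward error is $\eta_M^{\mathbb{S}}(\lambda,x,P):=\inf\{|||\Delta P|||_M:\Delta P\in\mathbb{S},\ P(\lambda)x+\Delta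 P(\lambda)x=0\}$.
   Formalization: The claim that η_2^S = η for m odd and |λ| = 1 is false as stated (n = m = 1, P(z) = z, λ = x = 1 gives η_2^S = 1 but η = 1/√2); it is replaced by: in that case η_2^S = η if and only if x^T r = 0. *)

theory Defs
  imports "HOL-Analysis.Analysis" "HOL-Computational_Algebra.Polynomial"
begin

section \<open>Complex vectors and matrices\<close>

definition cnj_vec :: "complex ^ 'n \<Rightarrow> complex ^ 'n" where
  "cnj_vec v = (\<chi> i. cnj (v $ i))"

text \<open>\<open>tdot x y\<close> is the bilinear product $x^T y$, \<open>hdot x y\<close> the Hermitian product $x^H y$.\<close>

definition tdot :: "complex ^ 'n \<Rightarrow> complex ^ 'n \<Rightarrow> complex" where
  "tdot x y = (\<Sum>i\<in>UNIV. x $ i * y $ i)"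

definition hdot :: "complex ^ 'n \<Rightarrow> complex ^ 'n \<Rightarrow> complex" where
  "hdot x y = (\<Sum>i\<in>UNIV. cnj (x $ i) * y $ i)"

text \<open>\<open>outer a b\<close> is the rank-one matrix $a b^T$, without conjugation.\<close>

definition outer :: "complex ^ 'n \<Rightarrow> complex ^ 'n \<Rightarrow> complex ^ 'n ^ 'n" where
  "outer a b = (\<chi> i k. a $ i * b $ k)"

text \<open>The library's scalar multiplication on matrices only takes real scalars.\<close>

definition mscale :: "complex \<Rightarrow> complex ^ 'n ^ 'n \<Rightarrow> complex ^ 'n ^ 'n" where
  "mscale c A = map_matrix (\<lambda>a. c * a) A"

text \<open>$P_x = I - x x^H$\<close>

definition Px :: "complex ^ 'n \<Rightarrow> complex ^ 'n ^ 'n" where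
  "Px x = mat 1 - outer x (cnj_vec x)"


section \<open>Matrix polynomials\<close>

text \<open>
  A matrix polynomial $\sum_j z^j A_j$ is a polynomial whose coefficients are matrices.
  The library's \<open>poly\<close> cannot evaluate it, since square matrices are not a commutative
  semiring and the argument is a complex number.
\<close>

type_synonym 'n mpoly = "((complex, 'n) vec, 'n) vec poly"

definition mpeval :: "'n::finite mpoly \<Rightarrow> complex \<Rightarrow> complex ^ 'n ^ 'n" where
  "mpeval P z = (\<Sum>j\<le>degree P. mscale (z ^ j) (coeff P j))"

definition mpoly_space :: "nat \<Rightarrow> 'n::finite mpoly set" where
  "mpoly_space m = {P. degree P \<le> m}"

definition regular_mpoly :: "'n::finite mpoly \<Rightarrow> bool" where
  "regular_mpoly P \<longleftrightarrow> (\<exists>z. det (mpeval P z) \<noteq> 0)"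

definition T_odd :: "nat \<Rightarrow> 'n::finite mpoly set" where
  "T_odd m = {P \<in> mpoly_space m. \<forall>z. transpose (mpeval P z) = - mpeval P (- z)}"


section \<open>Norms and backward errors\<close>

text \<open>
  \<open>Fro\<close> is the Frobenius norm: the library norm on \<open>complex ^ 'n ^ 'n\<close> is the Euclidean norm
  of the Euclidean norms of the rows. \<open>Two\<close> is the spectral norm, the operator norm induced by
  the Euclidean norm.
\<close>

datatype norm_type = Two | Fro

fun matnorm :: "norm_type \<Rightarrow> complex ^ 'n ^ 'n \<Rightarrow> real" where
  "matnorm Two A = onorm (\<lambda>v. A *v v)"
| "matnorm Fro A = norm A"

definition mpnorm :: "norm_type \<Rightarrow> nat \<Rightarrow> 'n::finite mpoly \<Rightarrow> real" where
  "mpnorm M m P = sqrt (\<Sum>j\<le>m. (matnorm M (coeff P j))\<^sup>2)"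

definition backward_err ::
  "norm_type \<Rightarrow> nat \<Rightarrow> complex \<Rightarrow> complex ^ 'n \<Rightarrow> 'n::finite mpoly \<Rightarrow> real" where
  "backward_err M m lam x P =
     Inf {mpnorm M m \<Delta>P | \<Delta>P.
            \<Delta>P \<in> mpoly_space m \<and> mpeval P lam *v x + mpeval \<Delta>P lam *v x = 0}"

definition structured_backward_err ::
  "'n::finite mpoly set \<Rightarrow> norm_type \<Rightarrow> nat \<Rightarrow> complex \<Rightarrow> complex ^ 'n \<Rightarrow> 'n mpoly \<Rightarrow> real" where
  "structured_backward_err S M m lam x P =
     Inf {mpnorm M m \<Delta>P | \<Delta>P. \<Delta>P \<in> S \<and> mpeval P lam *v x + mpeval \<Delta>P lam *v x = 0}"


section \<open>Index projections\<close>

text \<open>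
  A vector $[v_0, \ldots, v_m]^T$ is a function on \<open>nat\<close> of which only the values
  at \<open>0, \<dots>, m\<close> are used.
\<close>

definition vnorm :: "nat \<Rightarrow> (nat \<Rightarrow> complex) \<Rightarrow> real" where
  "vnorm m v = L2_set (\<lambda>j. cmod (v j)) {..m}"

definition Lam :: "complex \<Rightarrow> nat \<Rightarrow> complex" where
  "Lam lam j = lam ^ j"

definition even_proj :: "(nat \<Rightarrow> complex) \<Rightarrow> nat \<Rightarrow> complex" where
  "even_proj v j = (if even j then v j else 0)"

definition odd_proj :: "(nat \<Rightarrow> complex) \<Rightarrow> nat \<Rightarrow> complex" where
  "odd_proj v j = v j - even_proj v j"


section \<open>The optimal perturbations\<close>

text \<open>
  In the two definitions below, $\|(I-\Pi_e)\Lambda_m\|_2 = 0$ exactly if $\lambda = 0$ (for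
  $m \ge 1$), and $\|r\|_2^2 - |x^Tr|^2 = 0$ exactly if $|x^Tr| = \|r\|_2$.
  Terms with these denominators are then meant to be zero, which is what \<open>c / 0 = 0\<close> yields.
\<close>

definition Fcoeff ::
  "nat \<Rightarrow> complex \<Rightarrow> complex ^ 'n \<Rightarrow> complex ^ 'n \<Rightarrow> nat \<Rightarrow> complex ^ 'n ^ 'n" where
  "Fcoeff m lam x r j =
     (if even j then
        mscale (cnj (lam ^ j) / of_real ((vnorm m (Lam lam))\<^sup>2))
          (outer (transpose (Px x) *v r) (cnj_vec x) - outer (cnj_vec x) (r v* Px x))
      else
        mscale (cnj (lam ^ j) * tdot x r / of_real ((vnorm m (odd_proj (Lam lam)))\<^sup>2))
          (outer (cnj_vec x) (cnj_vec x))
        + mscale (cnj (lam ^ j) / of_real ((vnorm m (Lam lam))\<^sup>2))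
            (outer (cnj_vec x) (r v* Px x) + outer (transpose (Px x) *v r) (cnj_vec x)))"

definition Acoeff ::
  "nat \<Rightarrow> complex \<Rightarrow> complex ^ 'n \<Rightarrow> complex ^ 'n \<Rightarrow> nat \<Rightarrow> complex ^ 'n ^ 'n" where
  "Acoeff m lam x r j =
     (if even j then Fcoeff m lam x r j
      else Fcoeff m lam x r j
        - mscale (cnj (lam ^ j) * cnj (tdot x r) /
                    of_real ((vnorm m (odd_proj (Lam lam)))\<^sup>2 * ((norm r)\<^sup>2 - (cmod (tdot x r))\<^sup>2)))
            (outer (transpose (Px x) *v r) (r v* Px x)))"

definition mpoly_of :: "nat \<Rightarrow> (nat \<Rightarrow> complex ^ 'n ^ 'n) \<Rightarrow> 'n::finite mpoly" where
  "mpoly_of m A = (\<Sum>j\<le>m. monom (A j) j)"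

end

theory Submission
  imports Defs
begin

text \<open>
  The coefficients $D_j$ of a $T$-odd polynomial are skew-symmetric for even $j$ and symmetric for
  odd $j$, so $x^T D_j x = 0$ for even $j$. By these symmetries the real inner product of $(F_j)_j$
  with $(D_j)_j$ depends on $(D_j)_j$ only through the vector $\sum_j \lambda^j D_j x$. Hence it
  takes the same value on all feasible perturbations, among them $(F_j)_j$ itself, and Pythagoras
  yields the Frobenius minimum together with its uniqueness. The same argument for the vectors
  $F_j x$ and $D_j x$ bounds $\sum_j \|D_j x\|^2$, and so the spectral norm, from below. The bound
  is attained by $\Delta A_j$, since $\Delta A_j x = F_j x$ and $\|\Delta A_j\|_2 = \|F_j x\|_2$.
\<close>

section \<open>Bilinear and Hermitian products\<close>

lemma cnj_vec_nth [simp]: "cnj_vec v $ i = cnj (v $ i)"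
  by (simp add: cnj_vec_def)

lemma outer_nth [simp]: "outer a b $ i $ k = a $ i * b $ k"
  by (simp add: outer_def)

lemma mscale_nth [simp]: "mscale c A $ i $ k = c * A $ i $ k"
  by (simp add: mscale_def map_matrix_def)

lemma cnj_vec_cnj_vec [simp]: "cnj_vec (cnj_vec v) = v"
  by (simp add: vec_eq_iff)

lemma norm_cnj_vec [simp]: "norm (cnj_vec v) = norm v"
  by (simp add: norm_vec_def)

lemma of_real_cmod_square: "(complex_of_real (cmod z))\<^sup>2 = z * cnj z"
  by (metis complex_norm_square of_real_power)

lemma norm_scalar_mult: "norm (c *s v) = cmod c * norm v"
  for v :: "complex ^ 'n"
  by (simp add: norm_vec_def norm_mult L2_set_right_distrib)

lemma hdot_eq_tdot: "hdot u v = tdot (cnj_vec u) v"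
  by (simp add: hdot_def tdot_def)

lemma tdot_commute: "tdot u v = tdot v u"
  by (simp add: tdot_def mult.commute)

lemma tdot_right:
  "tdot u (v + w) = tdot u v + tdot u w"
  "tdot u (v - w) = tdot u v - tdot u w"
  "tdot u (- v) = - tdot u v"
  "tdot u (c *s v) = c * tdot u v"
  "tdot u 0 = 0"
  by (simp_all add: tdot_def ring_distribs sum.distrib sum_subtractf sum_negf sum_distrib_left ac_simps)

lemma tdot_sum_right: "tdot u (\<Sum>j\<in>S. f j) = (\<Sum>j\<in>S. tdot u (f j))"
  by (simp add: tdot_def sum_distrib_left) (rule sum.swap)

lemma hdot_right:
  "hdot u (v + w) = hdot u v + hdot u w"
  "hdot u (v - w) = hdot u v - hdot u w"
  "hdot u (c *s v) = c * hdot u v"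
  "hdot u 0 = 0"
  by (simp_all add: hdot_eq_tdot tdot_right)

lemma hdot_sum_right: "hdot u (\<Sum>j\<in>S. f j) = (\<Sum>j\<in>S. hdot u (f j))"
  by (simp add: hdot_eq_tdot tdot_sum_right)

lemma cnj_hdot: "cnj (hdot u v) = hdot v u"
  by (simp add: hdot_def mult.commute)

lemma hdot_left:
  "hdot (v + w) u = hdot v u + hdot w u"
  "hdot (c *s v) u = cnj c * hdot v u"
  by (simp_all add: hdot_def ring_distribs sum.distrib sum_distrib_left ac_simps)

lemma inner_eq_Re_hdot: "inner u v = Re (hdot u v)"
  by (simp add: inner_vec_def hdot_def inner_complex_def)

lemma hdot_self: "hdot v v = of_real ((norm v)\<^sup>2)"
proof -
  have "Im (hdot v v) = 0"
    by (simp add: hdot_def mult.commute)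
  then show ?thesis
    by (simp add: complex_eq_iff power2_norm_eq_inner inner_eq_Re_hdot)
qed

text \<open>Triangle inequality, then the real Cauchy-Schwarz inequality for the moduli of the
  entries.\<close>

lemma norm_tdot_le: "cmod (tdot u v) \<le> norm u * norm v"
proof -
  have "cmod (tdot u v) \<le> (\<Sum>i\<in>UNIV. \<bar>cmod (u $ i)\<bar> * \<bar>cmod (v $ i)\<bar>)"
    unfolding tdot_def by (rule order_trans[OF norm_sum]) (simp add: norm_mult)
  also have "\<dots> \<le> norm u * norm v"
    unfolding norm_vec_def by (rule L2_set_mult_ineq)
  finally show ?thesis .
qed

lemma norm_orthogonal_combination:
  assumes "norm y = 1" "hdot y w = 0"
  shows "(norm (a *s y + b *s w))\<^sup>2 = (cmod a)\<^sup>2 + (cmod b)\<^sup>2 * (norm w)\<^sup>2"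
proof -
  have wy: "hdot w y = 0"
    using cnj_hdot[of y w] assms(2) by simp
  have "hdot (a *s y + b *s w) (a *s y + b *s w)
      = of_real ((cmod a)\<^sup>2 + (cmod b)\<^sup>2 * (norm w)\<^sup>2)"
    by (simp add: hdot_left hdot_right wy assms hdot_self[of y] hdot_self[of w]
        of_real_cmod_square ac_simps)
  then show ?thesis
    unfolding hdot_self of_real_eq_iff .
qed

text \<open>Junk value: for \<open>w = 0\<close> the second term on the left is \<open>0 / 0 = 0\<close>.\<close>

lemma bessel_two:
  assumes y: "norm y = 1" and yw: "hdot y w = 0"
  shows "(cmod (tdot y v))\<^sup>2 + (cmod (tdot w v))\<^sup>2 / (norm w)\<^sup>2 \<le> (norm v)\<^sup>2"
proof -
  let ?p = "tdot y v" and ?q = "tdot w v" and ?W = "(norm w)\<^sup>2"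
  let ?T = "(cmod ?p)\<^sup>2 + (cmod ?q)\<^sup>2 / ?W"
  \<comment> \<open>\<open>?u\<close> is the conjugate of the projection of \<open>v\<close> onto
    the span of \<open>cnj_vec y\<close> and \<open>cnj_vec w\<close>. Both \<open>tdot ?u v\<close>
    and the squared norm of \<open>?u\<close> equal \<open>?T\<close>, so Cauchy-Schwarz gives the
    bound.\<close>
  let ?u = "cnj ?p *s y + (cnj ?q / of_real ?W) *s w"
  have T: "?T \<ge> 0" by simp
  have "tdot ?u v = cnj ?p * ?p + cnj ?q / of_real ?W * ?q"
    by (simp add: tdot_commute[of _ v] tdot_right)
  also have "\<dots> = of_real ?T"
    by (simp add: of_real_cmod_square ac_simps)
  finally have tu: "cmod (tdot ?u v) = ?T"
    using T by (simp only: norm_of_real abs_of_nonneg)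
  have "(cmod ?q / ?W)\<^sup>2 * ?W = (cmod ?q)\<^sup>2 / ?W"
    by (simp add: power2_eq_square)
  then have "(norm ?u)\<^sup>2 = ?T"
    by (simp add: norm_orthogonal_combination[OF y yw] norm_divide norm_power)
  then have nu: "norm ?u = sqrt ?T"
    by (metis norm_ge_zero real_sqrt_unique)
  have "?T \<le> sqrt ?T * norm v"
    using norm_tdot_le[of ?u v] unfolding tu nu .
  then have le: "sqrt ?T * sqrt ?T \<le> sqrt ?T * norm v"
    unfolding real_sqrt_mult_self abs_of_nonneg[OF T] .
  have "sqrt ?T \<le> norm v"
  proof (cases "sqrt ?T = 0")
    case False
    then have "0 < sqrt ?T"
      using real_sqrt_ge_zero[OF T] by linarith
    then show ?thesis
      using le by (rule mult_left_le_imp_le[rotated])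
  qed simp
  then show ?thesis
    by (rule sqrt_le_D)
qed

text \<open>
  The matrix with rows \<open>(\<sigma>, t)\<close> and \<open>(t, - cnj \<sigma>)\<close>, \<open>t = sqrt W / n\<close>, is a multiple of a unitary one;
  here it is applied to \<open>(p, q / sqrt W)\<close>.
\<close>

lemma norm_scaled_unitary:
  fixes \<sigma> p q :: complex and n W :: real
  assumes "W = 0 \<Longrightarrow> q = 0"
  shows "(cmod (\<sigma> * p + q / of_real n))\<^sup>2 + (cmod (p / of_real n - cnj \<sigma> * q / of_real W))\<^sup>2 * W
    = ((cmod \<sigma>)\<^sup>2 + W / n\<^sup>2) * ((cmod p)\<^sup>2 + (cmod q)\<^sup>2 / W)"
proof -
  let ?L = "(cmod (\<sigma> * p + q / of_real n))\<^sup>2 + (cmod (p / of_real n - cnj \<sigma> * q / of_real W))\<^sup>2 * W"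
    and ?R = "((cmod \<sigma>)\<^sup>2 + W / n\<^sup>2) * ((cmod p)\<^sup>2 + (cmod q)\<^sup>2 / W)"
  \<comment> \<open>With squared moduli written as \<open>z * cnj z\<close>, this is an identity of
    fractions; the zero denominators rely on division by zero being zero.\<close>
  have "complex_of_real ?L = complex_of_real ?R"
    using assms
    by (cases "W = 0"; cases "n = 0")
      (simp_all add: of_real_cmod_square power2_eq_square[of "complex_of_real n"] field_simps)
  then show ?thesis
    unfolding of_real_eq_iff .
qed

section \<open>Matrices\<close>

lemma mscale_mult_vector: "mscale c A *v v = c *s (A *v v)"
  by (simp add: vec_eq_iff matrix_vector_mult_def sum_distrib_left ac_simps)

lemma outer_mult_vector: "outer a b *v v = tdot b v *s a"
  by (simp add: vec_eq_iff matrix_vector_mult_def tdot_def sum_distrib_left ac_simps)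

lemma sum_mult_vector: "(\<Sum>j\<in>S. A j) *v v = (\<Sum>j\<in>S. A j *v v)"
  for v :: "complex ^ 'n"
  by (induction S rule: infinite_finite_induct) (simp_all add: matrix_vector_mult_add_rdistrib)

lemma sum_scalar_mult: "(\<Sum>j\<in>S. c j *s v) = (\<Sum>j\<in>S. c j) *s v"
  for v :: "complex ^ 'n"
  by (simp add: vec_eq_iff sum_distrib_right)

lemma transpose_nth [simp]: "transpose A $ i $ k = A $ k $ i"
  by (simp add: transpose_def)

text \<open>A scalar equals its own transpose. This turns the symmetry of a coefficient into a
  relation between its values.\<close>

lemma hdot_transpose: "hdot u (transpose A *v cnj_vec v) = hdot v (A *v cnj_vec u)"
  by (simp add: hdot_def matrix_vector_mult_def sum_distrib_left ac_simps) (rule sum.swap)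

text \<open>The Frobenius inner product is the real part of a trace, and against a rank-one matrix
  the trace collapses to a single value of \<open>D\<close>.\<close>

lemma inner_outer: "inner (outer a b) D = Re (hdot a (D *v cnj_vec b))"
  by (simp add: inner_vec_def hdot_def matrix_vector_mult_def inner_complex_def sum_distrib_left
      algebra_simps)

lemma inner_mscale_outer:
  "inner (mscale c (outer a b)) D = Re (cnj c * hdot a (D *v cnj_vec b))"
proof -
  have "mscale c (outer a b) = outer (c *s a) b"
    by (simp add: vec_eq_iff)
  then show ?thesis
    by (simp only: inner_outer hdot_left)
qed

lemma mscale_add: "mscale c (A + B) = mscale c A + mscale c B"
  by (simp add: vec_eq_iff distrib_left)

lemma mscale_diff: "mscale c (A - B) = mscale c A - mscale c B"
  by (simp add: vec_eq_iff right_diff_distrib)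

text \<open>Cauchy-Schwarz in each row.\<close>

lemma norm_matrix_vector_le: "norm (A *v v) \<le> norm A * norm v"
  for A :: "complex ^ 'n ^ 'm"
proof -
  have "norm (A *v v) = L2_set (\<lambda>i. cmod (tdot (A $ i) v)) UNIV"
    by (simp add: norm_vec_def matrix_vector_mult_def tdot_def)
  also have "\<dots> \<le> L2_set (\<lambda>i. norm (A $ i) * norm v) UNIV"
    by (intro L2_set_mono norm_tdot_le) simp
  also have "\<dots> = norm A * norm v"
    by (simp add: norm_vec_def[of A] L2_set_left_distrib)
  finally show ?thesis .
qed

lemma norm_outer: "norm (outer a b) = norm a * norm b"
proof -
  have "outer a b $ i = a $ i *s b" for i
    by (simp add: vec_eq_iff)
  then show ?thesis
    by (simp add: norm_vec_def[of "outer a b"] norm_vec_def[of a] norm_scalar_mult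
        L2_set_left_distrib)
qed

lemma matnorm_nonneg: "0 \<le> matnorm M A"
  by (cases M) (simp_all add: onorm_pos_le)

lemma norm_mult_vector_le_matnorm: "norm (A *v v) \<le> matnorm M A * norm v"
  by (cases M) (simp_all add: norm_matrix_vector_le onorm)

lemma matnorm_outer_le: "matnorm M (outer a b) \<le> norm a * norm b"
proof (cases M)
  case Two
  have "onorm ((*v) (outer a b)) \<le> norm a * norm b"
    by (rule onorm_bound)
      (simp_all add: order_trans[OF norm_matrix_vector_le] norm_outer)
  with Two show ?thesis by simp
qed (simp add: norm_outer)

section \<open>Coefficients of T-odd polynomials\<close>

lemma mpeval_mpoly_space:
  assumes "Q \<in> mpoly_space m"
  shows "mpeval Q z = (\<Sum>j\<le>m. mscale (z ^ j) (coeff Q j))"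
  unfolding mpeval_def
proof (rule sum.mono_neutral_left)
  show "{..degree Q} \<subseteq> {..m}"
    using assms by (simp add: mpoly_space_def)
  show "\<forall>j\<in>{..m} - {..degree Q}. mscale (z ^ j) (coeff Q j) = 0"
    by (simp add: coeff_eq_0 vec_eq_iff)
qed simp

text \<open>Each entry of the identity in \<open>z\<close> equates two polynomial functions, hence
  their coefficients.\<close>

lemma T_odd_iff:
  "Q \<in> T_odd m \<longleftrightarrow>
     Q \<in> mpoly_space m \<and>
     (\<forall>j\<le>m. transpose (coeff Q j) = (if even j then - coeff Q j else coeff Q j))"
proof (cases "Q \<in> mpoly_space m")
  case True
  \<comment> \<open>The factor \<open>- ((- 1) ^ j)\<close> is -1 for even and 1 for odd
    \<open>j\<close>, which merges the two symmetry cases.\<close>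
  have eq: "transpose (coeff Q j) = (if even j then - coeff Q j else coeff Q j) \<longleftrightarrow>
      (\<forall>i k. coeff Q j $ k $ i = - ((- 1) ^ j) * coeff Q j $ i $ k)" for j
    by (cases "even j") (simp_all add: vec_eq_iff)
  have "transpose (mpeval Q z) = - mpeval Q (- z) \<longleftrightarrow>
      (\<forall>i k. (\<Sum>j\<le>m. coeff Q j $ k $ i * z ^ j)
         = (\<Sum>j\<le>m. (- ((- 1) ^ j) * coeff Q j $ i $ k) * z ^ j))" for z
    unfolding mpeval_mpoly_space[OF True] vec_eq_iff
    by (simp add: sum_negf power_minus[of z] ac_simps)
  then have "(\<forall>z. transpose (mpeval Q z) = - mpeval Q (- z)) \<longleftrightarrow>
      (\<forall>i k. \<forall>z. (\<Sum>j\<le>m. coeff Q j $ k $ i * z ^ j)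
         = (\<Sum>j\<le>m. (- ((- 1) ^ j) * coeff Q j $ i $ k) * z ^ j))"
    by blast
  also have "\<dots> \<longleftrightarrow>
      (\<forall>i k. \<forall>j\<le>m. coeff Q j $ k $ i = - ((- 1) ^ j) * coeff Q j $ i $ k)"
    unfolding polyfun_eq_coeffs ..
  also have "\<dots> \<longleftrightarrow>
      (\<forall>j\<le>m. transpose (coeff Q j) = (if even j then - coeff Q j else coeff Q j))"
    using eq by blast
  finally show ?thesis
    using True by (simp add: T_odd_def)
qed (simp add: T_odd_def)

lemma coeff_mpoly_of: "coeff (mpoly_of m A) j = (if j \<le> m then A j else 0)"
  by (simp add: mpoly_of_def coeff_sum)

lemma mpoly_of_in_mpoly_space: "mpoly_of m A \<in> mpoly_space m"
  by (simp add: mpoly_space_def coeff_mpoly_of degree_le)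

lemma vnorm_square: "(vnorm m v)\<^sup>2 = (\<Sum>j\<le>m. (cmod (v j))\<^sup>2)"
  by (simp add: vnorm_def L2_set_def sum_nonneg)

lemma sum_Lam: "(\<Sum>j\<le>m. lam ^ j * cnj (lam ^ j)) = of_real ((vnorm m (Lam lam))\<^sup>2)"
  by (simp add: vnorm_square Lam_def complex_norm_square del: of_real_power complex_cnj_power)

lemma sum_odd_Lam:
  "(\<Sum>j\<le>m. if even j then 0 else lam ^ j * cnj (lam ^ j))
     = of_real ((vnorm m (odd_proj (Lam lam)))\<^sup>2)"
  unfolding vnorm_square of_real_sum
  by (rule sum.cong)
    (simp_all add: Lam_def odd_proj_def even_proj_def complex_norm_square
      del: of_real_power complex_cnj_power)

lemma vnorm_Lam_pos: "0 < (vnorm m (Lam lam))\<^sup>2"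
proof -
  have "(\<Sum>j\<in>{0}. (cmod (Lam lam j))\<^sup>2) \<le> (\<Sum>j\<le>m. (cmod (Lam lam j))\<^sup>2)"
    by (rule sum_mono2) auto
  then show ?thesis
    by (simp add: vnorm_square Lam_def)
qed

text \<open>The index 1 alone contributes a positive term, and \<open>m \<ge> 1\<close> puts it in
  range.\<close>

lemma vnorm_odd_Lam_pos:
  assumes "m \<ge> 1" "lam \<noteq> 0"
  shows "0 < (vnorm m (odd_proj (Lam lam)))\<^sup>2"
proof -
  let ?f = "\<lambda>j. (cmod (odd_proj (Lam lam) j))\<^sup>2"
  have "0 < (\<Sum>j\<in>{1}. ?f j)"
    using assms by (simp add: odd_proj_def even_proj_def Lam_def)
  also have "\<dots> \<le> (\<Sum>j\<le>m. ?f j)"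
    by (rule sum_mono2) (use assms in auto)
  finally show ?thesis
    by (simp add: vnorm_square)
qed

section \<open>Minimal perturbations\<close>

text \<open>If \<open>f\<close> pairs with \<open>g\<close> as with itself, then
  \<open>g - f\<close> is orthogonal to \<open>f\<close>. The last sum is the defect that vanishes
  only for \<open>g = f\<close> on a finite index set.\<close>

lemma sum_norm_pythagoras:
  fixes f g :: "'i \<Rightarrow> 'a::real_inner"
  assumes "(\<Sum>j\<in>S. inner (f j) (g j)) = E" "(\<Sum>j\<in>S. inner (f j) (f j)) = E"
  shows "(\<Sum>j\<in>S. (norm (g j))\<^sup>2) = E + (\<Sum>j\<in>S. (norm (g j - f j))\<^sup>2)"
proof -
  have "(\<Sum>j\<in>S. (norm (g j - f j))\<^sup>2)
      = (\<Sum>j\<in>S. (norm (g j))\<^sup>2) - 2 * (\<Sum>j\<in>S. inner (f j) (g j)) + (\<Sum>j\<in>S. inner (f j) (f j))"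
    by (simp add: power2_norm_eq_inner inner_diff_left inner_diff_right inner_commute
        sum_subtractf sum.distrib sum_distrib_left algebra_simps)
  then show ?thesis
    using assms by simp
qed

text \<open>The component $P_x^T r$ of $r$ orthogonal to $\bar x$.\<close>

definition tperp :: "complex ^ 'n \<Rightarrow> complex ^ 'n \<Rightarrow> complex ^ 'n" where
  "tperp x r = r - tdot x r *s cnj_vec x"

text \<open>Stated for coefficient sequences, so that it applies to \<open>Fcoeff\<close> and
  \<open>Acoeff\<close> before they are made into polynomials.\<close>

definition odd_feasible ::
  "nat \<Rightarrow> complex \<Rightarrow> complex ^ 'n \<Rightarrow> complex ^ 'n \<Rightarrow> (nat \<Rightarrow> complex ^ 'n ^ 'n) \<Rightarrow> bool" where
  "odd_feasible m lam x r A \<longleftrightarrow>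
     (\<forall>j\<le>m. transpose (A j) = (if even j then - A j else A j)) \<and>
     (\<Sum>j\<le>m. lam ^ j *s (A j *v x)) = r"

lemma odd_feasible_coeff_iff:
  assumes "Q \<in> mpoly_space m" "r = - (mpeval P lam *v x)"
  shows "odd_feasible m lam x r (coeff Q) \<longleftrightarrow>
    Q \<in> T_odd m \<and> mpeval P lam *v x + mpeval Q lam *v x = 0"
proof -
  have "mpeval P lam *v x + mpeval Q lam *v x = 0 \<longleftrightarrow> mpeval Q lam *v x = r"
    unfolding assms by (metis add.commute add_eq_0_iff)
  then show ?thesis
    using assms(1)
    by (simp add: odd_feasible_def T_odd_iff mpeval_mpoly_space sum_mult_vector mscale_mult_vector)
qed

lemma tperp_eq:
  "transpose (Px x) *v r = tperp x r" "r v* Px x = tperp x r"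
proof -
  have "transpose (Px x) = mat 1 - outer (cnj_vec x) x"
    by (simp add: vec_eq_iff Px_def mat_def)
  then show "transpose (Px x) *v r = tperp x r"
    by (simp add: tperp_def matrix_vector_mult_diff_rdistrib outer_mult_vector)
  then show "r v* Px x = tperp x r"
    by simp
qed

lemma tdot_transpose_self: "tdot x (transpose D *v x) = tdot x (D *v x)"
  using hdot_transpose[of "cnj_vec x" D "cnj_vec x"] by (simp add: hdot_eq_tdot)

text \<open>The quadratic form is its own negative. Hence only odd indices can produce the component
  of \<open>r\<close> along \<open>cnj_vec x\<close>.\<close>

lemma tdot_skew:
  assumes "transpose D = - D"
  shows "tdot x (D *v x) = 0"
proof -
  have "- D *v x = - (D *v x)"
    by (simp add: vec_eq_iff matrix_vector_mult_def sum_negf)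
  then show ?thesis
    using tdot_transpose_self[of x D] unfolding assms by (simp add: tdot_right)
qed

section \<open>Optimal perturbations for a unit vector\<close>

context
  fixes m :: nat and lam :: complex and x r :: "complex ^ 'n"
  assumes x: "norm x = 1"
begin

text \<open>Coordinates of the residual: \<open>r = s *s y + w\<close> with \<open>y\<close> a unit
  vector orthogonal to \<open>w\<close>.\<close>

private abbreviation (input) "s \<equiv> tdot x r"
private abbreviation (input) "y \<equiv> cnj_vec x"
private abbreviation (input) "w \<equiv> tperp x r"
private abbreviation (input) "N \<equiv> (vnorm m (Lam lam))\<^sup>2"
private abbreviation (input) "K \<equiv> (vnorm m (odd_proj (Lam lam)))\<^sup>2"

lemma tdot_cnj_unit: "tdot x y = 1" "tdot y x = 1"
  using hdot_self[of x] x by (simp_all add: hdot_eq_tdot tdot_commute)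

lemma tdot_tperp: "tdot x w = 0" "tdot w x = 0"
  by (simp_all add: tperp_def tdot_right tdot_cnj_unit tdot_commute[of _ x])

lemma hdot_cnj_tperp: "hdot y w = 0" "hdot w y = 0"
proof -
  show "hdot y w = 0"
    by (simp add: hdot_eq_tdot tdot_tperp)
  then show "hdot w y = 0"
    using cnj_hdot[of y w] by simp
qed

text \<open>The factor \<open>1\<close> matches the shape of
  \<open>norm_orthogonal_combination\<close>, where the equation is folded.\<close>

lemma tperp_decomp: "r = s *s y + 1 *s w"
  by (simp add: tperp_def)

lemma norm_tperp: "(norm w)\<^sup>2 = (norm r)\<^sup>2 - (cmod s)\<^sup>2"
  using norm_orthogonal_combination[of y w s 1, folded tperp_decomp] x hdot_cnj_tperp by simp

lemma hdot_tperp: "hdot w r = of_real ((norm w)\<^sup>2)"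
proof -
  have "hdot w r = hdot w (s *s y + 1 *s w)"
    by (rule arg_cong[OF tperp_decomp])
  then show ?thesis
    by (simp add: hdot_right hdot_cnj_tperp hdot_self del: of_real_power)
qed

text \<open>The block \<open>outer y w\<close> only makes the coefficient skew or symmetric; it
  annihilates \<open>x\<close> since \<open>tdot w x = 0\<close>.\<close>

lemma Fcoeff_mult_vector:
  "Fcoeff m lam x r j *v x
     = (if even j then 0 else cnj (lam ^ j) * s / of_real K) *s y + (cnj (lam ^ j) / of_real N) *s w"
  by (simp add: Fcoeff_def tperp_eq matrix_vector_mult_diff_rdistrib matrix_vector_mult_add_rdistrib
      mscale_mult_vector outer_mult_vector tdot_cnj_unit tdot_tperp vec_eq_iff)

lemma Fcoeff_transpose:
  "transpose (Fcoeff m lam x r j) = (if even j then - Fcoeff m lam x r j else Fcoeff m lam x r j)"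
  by (simp add: Fcoeff_def tperp_eq vec_eq_iff algebra_simps)

text \<open>The blocks \<open>outer w y\<close> and \<open>outer y w\<close> contribute equally by
  the symmetry of \<open>D\<close>, hence the factor 2. For even \<open>j\<close> the first term is
  zero by \<open>tdot_skew\<close>, so one formula serves both parities.\<close>

lemma inner_Fcoeff:
  assumes D: "transpose D = (if even j then - D else D)"
  shows "inner (Fcoeff m lam x r j) D
    = Re (lam ^ j * (cnj s / of_real K * tdot x (D *v x) + 2 / of_real N * hdot w (D *v x)))"
proof (cases "even j")
  case True
  then have D: "transpose D = - D"
    using D by simp
  have "- D *v cnj_vec w = - (D *v cnj_vec w)"
    by (simp add: vec_eq_iff matrix_vector_mult_def sum_negf)
  then have "- hdot y (D *v cnj_vec w) = hdot w (D *v x)"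
    using hdot_transpose[of y D w] unfolding D by (simp add: hdot_eq_tdot tdot_right)
  then have "hdot y (D *v cnj_vec w) = - hdot w (D *v x)"
    by (metis minus_minus)
  then show ?thesis
    using True
    by (simp only: Fcoeff_def tperp_eq if_True mscale_diff inner_diff_left inner_mscale_outer
        cnj_vec_cnj_vec tdot_skew[OF D] minus_complex.sel(1)[symmetric])
      (rule arg_cong[where f = Re], simp add: algebra_simps)
next
  case False
  then have D: "transpose D = D"
    using D by simp
  have "hdot y (D *v cnj_vec w) = hdot w (D *v x)"
    using hdot_transpose[of y D w] unfolding D by simp
  moreover have "hdot y (D *v x) = tdot x (D *v x)"
    by (simp add: hdot_eq_tdot)
  ultimately show ?thesis
    using False
    by (simp only: Fcoeff_def tperp_eq if_False mscale_add inner_add_left inner_mscale_outer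
        cnj_vec_cnj_vec plus_complex.sel(1)[symmetric])
      (rule arg_cong[where f = Re], simp add: algebra_simps)
qed

text \<open>The functional of \<open>inner_Fcoeff\<close> with 1 in place of 2, because only one of
  the two blocks acts on \<open>x\<close>.\<close>

lemma inner_Fcoeff_mult_vector:
  assumes D: "transpose D = (if even j then - D else D)"
  shows "inner (Fcoeff m lam x r j *v x) (D *v x)
    = Re (lam ^ j * (cnj s / of_real K * tdot x (D *v x) + 1 / of_real N * hdot w (D *v x)))"
proof -
  have "even j \<Longrightarrow> tdot x (D *v x) = 0"
    using D by (simp add: tdot_skew)
  then show ?thesis
    unfolding inner_eq_Re_hdot Fcoeff_mult_vector hdot_left
    by (intro arg_cong[where f = Re]) (auto simp: hdot_eq_tdot[of y] algebra_simps)
qed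

text \<open>The sum is linear in the vectors \<open>A j *v x\<close> with weights
  \<open>lam ^ j\<close>, so it sees only their weighted sum \<open>r\<close>. It is used with
  \<open>c = 2\<close> for the Frobenius norm and \<open>c = 1\<close> for the spectral
  norm.\<close>

lemma sum_functional_feasible:
  assumes "odd_feasible m lam x r A"
  shows "(\<Sum>j\<le>m. Re (lam ^ j * (cnj s / of_real K * tdot x (A j *v x)
            + of_real c / of_real N * hdot w (A j *v x))))
    = (cmod s)\<^sup>2 / K + c * ((norm r)\<^sup>2 - (cmod s)\<^sup>2) / N"
proof -
  have "(\<Sum>j\<le>m. lam ^ j * (cnj s / of_real K * tdot x (A j *v x)
            + of_real c / of_real N * hdot w (A j *v x)))
      = cnj s / of_real K * tdot x (\<Sum>j\<le>m. lam ^ j *s (A j *v x))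
          + of_real c / of_real N * hdot w (\<Sum>j\<le>m. lam ^ j *s (A j *v x))"
    by (simp add: tdot_sum_right hdot_sum_right tdot_right hdot_right sum_distrib_left
        sum.distrib sum_divide_distrib algebra_simps)
  also have "\<dots> = cnj s / of_real K * s + of_real c / of_real N * of_real ((norm w)\<^sup>2)"
    using assms by (simp add: odd_feasible_def hdot_tperp)
  also have "\<dots> = of_real ((cmod s)\<^sup>2 / K + c * (norm w)\<^sup>2 / N)"
    by (simp add: of_real_cmod_square)
  finally show ?thesis
    unfolding Re_sum[symmetric] norm_tperp by simp
qed

lemma Fcoeff_feasible:
  assumes "K = 0 \<longrightarrow> s = 0"
  shows "odd_feasible m lam x r (Fcoeff m lam x r)"
proof -
  have "(\<Sum>j\<le>m. lam ^ j *s (Fcoeff m lam x r j *v x))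
     = ((\<Sum>j\<le>m. if even j then 0 else lam ^ j * cnj (lam ^ j)) * s / of_real K) *s y
       + ((\<Sum>j\<le>m. lam ^ j * cnj (lam ^ j)) / of_real N) *s w"
  proof -
    have "lam ^ j *s (Fcoeff m lam x r j *v x)
        = ((if even j then 0 else lam ^ j * cnj (lam ^ j)) * s / of_real K) *s y
          + (lam ^ j * cnj (lam ^ j) / of_real N) *s w" for j
      by (simp add: Fcoeff_mult_vector vec_eq_iff algebra_simps)
    then show ?thesis
      by (simp only: sum.distrib sum_scalar_mult sum_divide_distrib sum_distrib_right)
  qed
  also have "\<dots> = s *s y + 1 *s w"
    \<comment> \<open>The sums cancel \<open>N\<close> and \<open>K\<close>; if
      \<open>K = 0\<close>, the quotient is 0, which is then the value of \<open>s\<close>.\<close>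
    unfolding sum_Lam sum_odd_Lam using assms vnorm_Lam_pos[of m lam] by auto
  also have "\<dots> = r"
    by (rule tperp_decomp[symmetric])
  finally show ?thesis
    using Fcoeff_transpose by (simp add: odd_feasible_def)
qed

lemma sum_norm_feasible:
  assumes "K = 0 \<longrightarrow> s = 0" "odd_feasible m lam x r A"
  shows "(\<Sum>j\<le>m. (norm (A j))\<^sup>2)
    = (cmod s)\<^sup>2 / K + 2 * ((norm r)\<^sup>2 - (cmod s)\<^sup>2) / N
      + (\<Sum>j\<le>m. (norm (A j - Fcoeff m lam x r j))\<^sup>2)"
proof -
  \<comment> \<open>Stated for every feasible \<open>B\<close>: Pythagoras needs it for
    \<open>A\<close> and for \<open>Fcoeff\<close> itself.\<close>
  have *: "(\<Sum>j\<le>m. inner (Fcoeff m lam x r j) (B j))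
      = (cmod s)\<^sup>2 / K + 2 * ((norm r)\<^sup>2 - (cmod s)\<^sup>2) / N"
    if "odd_feasible m lam x r B" for B
  proof -
    have "inner (Fcoeff m lam x r j) (B j) = Re (lam ^ j * (cnj s / of_real K * tdot x (B j *v x)
            + of_real 2 / of_real N * hdot w (B j *v x)))" if "j \<in> {..m}" for j
      using \<open>odd_feasible m lam x r B\<close> that by (subst inner_Fcoeff) (simp_all add: odd_feasible_def)
    then show ?thesis
      unfolding sum_functional_feasible[OF that, symmetric] by (rule sum.cong[OF refl])
  qed
  show ?thesis
    by (rule sum_norm_pythagoras) (simp_all add: * assms Fcoeff_feasible)
qed

lemma sum_norm_mult_vector_feasible:
  assumes "K = 0 \<longrightarrow> s = 0" "odd_feasible m lam x r A"
  shows "(\<Sum>j\<le>m. (norm (A j *v x))\<^sup>2)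
    = (cmod s)\<^sup>2 / K + ((norm r)\<^sup>2 - (cmod s)\<^sup>2) / N
      + (\<Sum>j\<le>m. (norm (A j *v x - Fcoeff m lam x r j *v x))\<^sup>2)"
proof -
  have *: "(\<Sum>j\<le>m. inner (Fcoeff m lam x r j *v x) (B j *v x))
      = (cmod s)\<^sup>2 / K + 1 * ((norm r)\<^sup>2 - (cmod s)\<^sup>2) / N"
    if "odd_feasible m lam x r B" for B
  proof -
    have "inner (Fcoeff m lam x r j *v x) (B j *v x)
        = Re (lam ^ j * (cnj s / of_real K * tdot x (B j *v x)
            + of_real 1 / of_real N * hdot w (B j *v x)))" if "j \<in> {..m}" for j
      using \<open>odd_feasible m lam x r B\<close> that
      by (subst inner_Fcoeff_mult_vector) (simp_all add: odd_feasible_def)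
    then show ?thesis
      unfolding sum_functional_feasible[OF that, symmetric] by (rule sum.cong[OF refl])
  qed
  show ?thesis
    by (rule sum_norm_pythagoras) (use * in \<open>simp_all add: assms Fcoeff_feasible\<close>)
qed

section \<open>Spectral norm of the corrected coefficients\<close>

text \<open>The correction is a multiple of \<open>outer w w\<close>, and
  \<open>tdot w x = 0\<close>.\<close>

lemma Acoeff_mult_vector: "Acoeff m lam x r j *v x = Fcoeff m lam x r j *v x"
  by (simp add: Acoeff_def tperp_eq matrix_vector_mult_diff_rdistrib mscale_mult_vector
      outer_mult_vector tdot_tperp)

lemma Acoeff_feasible:
  assumes "K = 0 \<longrightarrow> s = 0"
  shows "odd_feasible m lam x r (Acoeff m lam x r)"
proof -
  have "transpose (B - mscale c (outer b b)) = transpose B - mscale c (outer b b)"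
    for B :: "complex ^ 'n ^ 'n" and b c
    by (simp add: vec_eq_iff)
  then have "transpose (Acoeff m lam x r j)
      = (if even j then - Acoeff m lam x r j else Acoeff m lam x r j)" for j
    using Fcoeff_transpose[of j] by (simp add: Acoeff_def tperp_eq)
  then show ?thesis
    using Fcoeff_feasible[OF assms] by (simp add: odd_feasible_def Acoeff_mult_vector)
qed

text \<open>
  For \<open>w \<noteq> 0\<close>, \<open>Acoeff m lam x r j\<close> vanishes on the orthogonal complement of the span of \<open>x\<close> and
  \<open>cnj_vec w\<close>, and maps this span to that of \<open>y\<close> and \<open>w\<close> by a multiple of a unitary map.
\<close>

lemma norm_Acoeff_mult_vector_le:
  "norm (Acoeff m lam x r j *v v) \<le> norm (Fcoeff m lam x r j *v x) * norm v"
proof -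
  \<comment> \<open>All blocks are of the form \<open>outer a y\<close> or \<open>outer a w\<close>,
    so \<open>v\<close> enters only through \<open>?p\<close> and \<open>?q\<close>.\<close>
  let ?c = "cnj (lam ^ j)" and ?p = "tdot y v" and ?q = "tdot w v" and ?W = "(norm w)\<^sup>2"
  have orth: "(norm (a *s y + b *s w))\<^sup>2 = (cmod a)\<^sup>2 + (cmod b)\<^sup>2 * ?W" for a b
    using norm_orthogonal_combination[of y w a b] x hdot_cnj_tperp by simp
  have q: "?q = 0" if "?W = 0"
    using that by (simp add: tdot_def)
  have bessel: "(cmod ?p)\<^sup>2 + (cmod ?q)\<^sup>2 / ?W \<le> (norm v)\<^sup>2"
    using bessel_two[of y w v] x hdot_cnj_tperp by simp
  have "(norm (Acoeff m lam x r j *v v))\<^sup>2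
      = (norm (Fcoeff m lam x r j *v x))\<^sup>2 * ((cmod ?p)\<^sup>2 + (cmod ?q)\<^sup>2 / ?W)"
  proof (cases "even j")
    case True
    have "Acoeff m lam x r j *v v = (- (?c / of_real N * ?q)) *s y + (?c / of_real N * ?p) *s w"
      using True
      by (simp add: Acoeff_def Fcoeff_def tperp_eq matrix_vector_mult_diff_rdistrib
          mscale_mult_vector outer_mult_vector vec_eq_iff algebra_simps)
    then have "(norm (Acoeff m lam x r j *v v))\<^sup>2
        = (cmod (?c / of_real N))\<^sup>2 * ((cmod ?q)\<^sup>2 + (cmod ?p)\<^sup>2 * ?W)"
      by (simp only: orth norm_minus_cancel norm_mult power_mult_distrib)
        (simp only: distrib_left mult.assoc)
    also have "(cmod ?q)\<^sup>2 + (cmod ?p)\<^sup>2 * ?W = ?W * ((cmod ?p)\<^sup>2 + (cmod ?q)\<^sup>2 / ?W)"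
      using q by (cases "?W = 0") (simp_all add: field_simps)
    finally show ?thesis
      using True by (simp add: Fcoeff_mult_vector orth[of 0, simplified] norm_scalar_mult
          power_mult_distrib)
  next
    case False
    let ?\<sigma> = "s / of_real K"
    \<comment> \<open>The correction supplies the term with \<open>cnj ?\<sigma>\<close>, the entry
      that completes a multiple of a unitary matrix.\<close>
    have "Acoeff m lam x r j *v v
        = (?c * (?\<sigma> * ?p + ?q / of_real N)) *s y
          + (?c * (?p / of_real N - cnj ?\<sigma> * ?q / of_real ?W)) *s w"
      using False
      by (simp add: Acoeff_def Fcoeff_def tperp_eq norm_tperp[symmetric]
          matrix_vector_mult_diff_rdistrib matrix_vector_mult_add_rdistrib
          mscale_mult_vector outer_mult_vector vec_eq_iff algebra_simps)
    then have "(norm (Acoeff m lam x r j *v v))\<^sup>2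
        = (cmod ?c)\<^sup>2 * ((cmod (?\<sigma> * ?p + ?q / of_real N))\<^sup>2
            + (cmod (?p / of_real N - cnj ?\<sigma> * ?q / of_real ?W))\<^sup>2 * ?W)"
      by (simp only: orth norm_mult power_mult_distrib)
        (simp only: distrib_left mult.assoc)
    also have "(cmod (?\<sigma> * ?p + ?q / of_real N))\<^sup>2
            + (cmod (?p / of_real N - cnj ?\<sigma> * ?q / of_real ?W))\<^sup>2 * ?W
        = ((cmod ?\<sigma>)\<^sup>2 + ?W / N\<^sup>2) * ((cmod ?p)\<^sup>2 + (cmod ?q)\<^sup>2 / ?W)"
      by (rule norm_scaled_unitary) (use q in simp)
    also have "(cmod ?c)\<^sup>2 * (((cmod ?\<sigma>)\<^sup>2 + ?W / N\<^sup>2) * ((cmod ?p)\<^sup>2 + (cmod ?q)\<^sup>2 / ?W))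
        = ((cmod (?c * s / of_real K))\<^sup>2 + (cmod (?c / of_real N))\<^sup>2 * ?W)
            * ((cmod ?p)\<^sup>2 + (cmod ?q)\<^sup>2 / ?W)"
      by (simp add: norm_mult norm_divide power_mult_distrib power_divide norm_power
          algebra_simps)
    finally show ?thesis
      using False by (simp only: Fcoeff_mult_vector orth if_False)
  qed
  also have "\<dots> \<le> (norm (Fcoeff m lam x r j *v x))\<^sup>2 * (norm v)\<^sup>2"
    using bessel by (rule mult_left_mono) simp
  finally show ?thesis
    by (simp flip: power_mult_distrib)
qed

lemma matnorm_Two_Acoeff_le: "matnorm Two (Acoeff m lam x r j) \<le> norm (Fcoeff m lam x r j *v x)"
  by (simp add: onorm_bound norm_Acoeff_mult_vector_le)

section \<open>Attained minima and backward errors\<close>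

text \<open>Each coefficient is tested on the unit vector \<open>x\<close>. Holding for both norms,
  this serves the structured spectral and the unstructured bound.\<close>

lemma mpnorm_ge: "sqrt (\<Sum>j\<le>m. (norm (coeff Q j *v x))\<^sup>2) \<le> mpnorm M m Q"
proof -
  have "norm (coeff Q j *v x) \<le> matnorm M (coeff Q j)" for j
    using norm_mult_vector_le_matnorm[of "coeff Q j" x M] x by simp
  then show ?thesis
    unfolding mpnorm_def by (intro real_sqrt_le_mono sum_mono power_mono) auto
qed

lemma mpnorm_Fro_feasible:
  assumes "K = 0 \<longrightarrow> s = 0" "odd_feasible m lam x r (coeff Q)"
  shows "mpnorm Fro m Q
    = sqrt ((cmod s)\<^sup>2 / K + 2 * ((norm r)\<^sup>2 - (cmod s)\<^sup>2) / N
        + (\<Sum>j\<le>m. (norm (coeff Q j - Fcoeff m lam x r j))\<^sup>2))"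
  using sum_norm_feasible[OF assms] by (simp add: mpnorm_def)

lemma odd_feasible_coeff_mpoly_of:
  "odd_feasible m lam x r (coeff (mpoly_of m A)) \<longleftrightarrow> odd_feasible m lam x r A"
  by (simp add: odd_feasible_def coeff_mpoly_of)

lemma mpnorm_Fro_Fcoeff:
  assumes "K = 0 \<longrightarrow> s = 0"
  shows "mpnorm Fro m (mpoly_of m (Fcoeff m lam x r))
    = sqrt ((cmod s)\<^sup>2 / K + 2 * ((norm r)\<^sup>2 - (cmod s)\<^sup>2) / N)"
  using Fcoeff_feasible[OF assms]
  by (subst mpnorm_Fro_feasible[OF assms]) (simp_all add: odd_feasible_coeff_mpoly_of coeff_mpoly_of)

lemma mpnorm_Two_feasible_ge:
  assumes "K = 0 \<longrightarrow> s = 0" "odd_feasible m lam x r (coeff Q)"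
  shows "sqrt ((cmod s)\<^sup>2 / K + ((norm r)\<^sup>2 - (cmod s)\<^sup>2) / N) \<le> mpnorm Two m Q"
  by (rule order_trans[OF _ mpnorm_ge])
    (simp add: sum_norm_mult_vector_feasible[OF assms] sum_nonneg)

text \<open>The spectral norms are at most those of the vectors
  \<open>Fcoeff m lam x r j *v x\<close>, whose squares sum to the lower bound.\<close>

lemma mpnorm_Two_Acoeff:
  assumes "K = 0 \<longrightarrow> s = 0"
  shows "mpnorm Two m (mpoly_of m (Acoeff m lam x r))
    = sqrt ((cmod s)\<^sup>2 / K + ((norm r)\<^sup>2 - (cmod s)\<^sup>2) / N)"
proof (rule antisym)
  have "mpnorm Two m (mpoly_of m (Acoeff m lam x r))
      \<le> sqrt (\<Sum>j\<le>m. (norm (Fcoeff m lam x r j *v x))\<^sup>2)"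
    unfolding mpnorm_def
    by (intro real_sqrt_le_mono sum_mono power_mono)
      (simp_all only: coeff_mpoly_of atMost_iff if_True matnorm_Two_Acoeff_le matnorm_nonneg)
  then show "mpnorm Two m (mpoly_of m (Acoeff m lam x r))
      \<le> sqrt ((cmod s)\<^sup>2 / K + ((norm r)\<^sup>2 - (cmod s)\<^sup>2) / N)"
    using sum_norm_mult_vector_feasible[OF assms Fcoeff_feasible[OF assms]] by simp
  show "sqrt ((cmod s)\<^sup>2 / K + ((norm r)\<^sup>2 - (cmod s)\<^sup>2) / N)
      \<le> mpnorm Two m (mpoly_of m (Acoeff m lam x r))"
    using Acoeff_feasible[OF assms]
    by (intro mpnorm_Two_feasible_ge[OF assms]) (simp_all add: odd_feasible_coeff_mpoly_of)
qed

text \<open>\<open>odd_feasible\<close> does not see coefficients beyond \<open>m\<close>, so the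
  degree bound stays a separate conjunct.\<close>

lemma T_odd_constraint_iff:
  assumes "r = - (mpeval P lam *v x)"
  shows "Q \<in> T_odd m \<and> mpeval P lam *v x + mpeval Q lam *v x = 0 \<longleftrightarrow>
    Q \<in> mpoly_space m \<and> odd_feasible m lam x r (coeff Q)"
  using odd_feasible_coeff_iff[OF _ assms] by (auto simp: T_odd_iff)

lemma structured_backward_err_Fro:
  assumes "r = - (mpeval P lam *v x)" "K = 0 \<longrightarrow> s = 0"
  shows "structured_backward_err (T_odd m) Fro m lam x P
    = sqrt ((cmod s)\<^sup>2 / K + 2 * ((norm r)\<^sup>2 - (cmod s)\<^sup>2) / N)"
  unfolding structured_backward_err_def T_odd_constraint_iff[OF assms(1)]
proof (rule cInf_eq_minimum)
  show "sqrt ((cmod s)\<^sup>2 / K + 2 * ((norm r)\<^sup>2 - (cmod s)\<^sup>2) / N)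
      \<in> {mpnorm Fro m Q |Q. Q \<in> mpoly_space m \<and> odd_feasible m lam x r (coeff Q)}"
    using mpnorm_Fro_Fcoeff[OF assms(2)] Fcoeff_feasible[OF assms(2)] mpoly_of_in_mpoly_space
      odd_feasible_coeff_mpoly_of by (metis (mono_tags, lifting) mem_Collect_eq)
next
  fix e assume "e \<in> {mpnorm Fro m Q |Q. Q \<in> mpoly_space m \<and> odd_feasible m lam x r (coeff Q)}"
  then show "sqrt ((cmod s)\<^sup>2 / K + 2 * ((norm r)\<^sup>2 - (cmod s)\<^sup>2) / N) \<le> e"
    by (auto simp: mpnorm_Fro_feasible[OF assms(2)] sum_nonneg)
qed

lemma structured_backward_err_Two:
  assumes "r = - (mpeval P lam *v x)" "K = 0 \<longrightarrow> s = 0"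
  shows "structured_backward_err (T_odd m) Two m lam x P
    = sqrt ((cmod s)\<^sup>2 / K + ((norm r)\<^sup>2 - (cmod s)\<^sup>2) / N)"
  unfolding structured_backward_err_def T_odd_constraint_iff[OF assms(1)]
proof (rule cInf_eq_minimum)
  show "sqrt ((cmod s)\<^sup>2 / K + ((norm r)\<^sup>2 - (cmod s)\<^sup>2) / N)
      \<in> {mpnorm Two m Q |Q. Q \<in> mpoly_space m \<and> odd_feasible m lam x r (coeff Q)}"
    using mpnorm_Two_Acoeff[OF assms(2)] Acoeff_feasible[OF assms(2)] mpoly_of_in_mpoly_space
      odd_feasible_coeff_mpoly_of by (metis (mono_tags, lifting) mem_Collect_eq)
next
  fix e assume "e \<in> {mpnorm Two m Q |Q. Q \<in> mpoly_space m \<and> odd_feasible m lam x r (coeff Q)}"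
  then show "sqrt ((cmod s)\<^sup>2 / K + ((norm r)\<^sup>2 - (cmod s)\<^sup>2) / N) \<le> e"
    using mpnorm_Two_feasible_ge[OF assms(2)] by auto
qed

text \<open>Optimality forces the Pythagorean defect to be zero.\<close>

lemma Fro_minimizer_unique:
  assumes "r = - (mpeval P lam *v x)" "K = 0 \<longrightarrow> s = 0"
    and Q: "Q \<in> T_odd m" "mpeval P lam *v x + mpeval Q lam *v x = 0"
    and opt: "mpnorm Fro m Q = structured_backward_err (T_odd m) Fro m lam x P"
  shows "Q = mpoly_of m (Fcoeff m lam x r)"
proof -
  have Q': "Q \<in> mpoly_space m" "odd_feasible m lam x r (coeff Q)"
    using Q T_odd_constraint_iff[OF assms(1)] by auto
  have "(\<Sum>j\<le>m. (norm (coeff Q j - Fcoeff m lam x r j))\<^sup>2) = 0"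
    using opt mpnorm_Fro_feasible[OF assms(2) Q'(2)] structured_backward_err_Fro[OF assms(1,2)]
    by simp
  then have "\<forall>j\<le>m. coeff Q j = Fcoeff m lam x r j"
    by (simp add: sum_nonneg_eq_0_iff)
  moreover have "\<forall>j>m. coeff Q j = 0"
    using Q'(1) by (simp add: mpoly_space_def coeff_eq_0)
  ultimately show ?thesis
    by (simp add: poly_eq_iff coeff_mpoly_of)
qed

text \<open>The same orthogonality argument without symmetry constraints; rank-one matrices attain
  the bound in both norms.\<close>

lemma backward_err_eq:
  assumes "r = - (mpeval P lam *v x)"
  shows "backward_err M m lam x P = norm r / sqrt N"
  unfolding backward_err_def
proof (rule cInf_eq_minimum)
  \<comment> \<open>The least-norm solution of the equation
    \<open>(\<Sum>j\<le>m. lam ^ j *s g j) = r\<close>.\<close>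
  define g where "g j = (cnj (lam ^ j) / of_real N) *s r" for j
  have N: "N > 0"
    by (rule vnorm_Lam_pos)
  have norm_g: "(\<Sum>j\<le>m. (norm (g j))\<^sup>2) = (norm r)\<^sup>2 / N"
  proof -
    have "(\<Sum>j\<le>m. (norm (g j))\<^sup>2) = (\<Sum>j\<le>m. (cmod (Lam lam j))\<^sup>2) * ((norm r)\<^sup>2 / N\<^sup>2)"
      unfolding sum_distrib_right g_def
      by (simp add: norm_scalar_mult norm_divide norm_power Lam_def power_mult_distrib power_divide)
    then show ?thesis
      unfolding vnorm_square[symmetric] using N by (simp add: power2_eq_square)
  qed
  have lower: "norm r / sqrt N \<le> mpnorm M m Q"
    and feasible: "(\<Sum>j\<le>m. lam ^ j *s (coeff Q j *v x)) = r"
    if Q: "Q \<in> mpoly_space m" "mpeval P lam *v x + mpeval Q lam *v x = 0" for M Q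
  proof -
    show r: "(\<Sum>j\<le>m. lam ^ j *s (coeff Q j *v x)) = r"
    proof -
      have "mpeval Q lam *v x = r"
        using Q(2) unfolding assms by (metis add.commute add_eq_0_iff)
      then show ?thesis
        using Q(1) by (simp add: mpeval_mpoly_space sum_mult_vector mscale_mult_vector)
    qed
    have "(\<Sum>j\<le>m. inner (g j) (coeff Q j *v x))
        = Re (hdot r (\<Sum>j\<le>m. lam ^ j *s (coeff Q j *v x)) / of_real N)"
      by (simp add: g_def inner_eq_Re_hdot hdot_left hdot_sum_right hdot_right sum_divide_distrib)
    also have "\<dots> = (norm r)\<^sup>2 / N"
      unfolding r hdot_self by (simp flip: of_real_power of_real_divide)
    finally have "(\<Sum>j\<le>m. inner (g j) (coeff Q j *v x)) = (norm r)\<^sup>2 / N" .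
    then have "(\<Sum>j\<le>m. (norm (coeff Q j *v x))\<^sup>2)
        = (norm r)\<^sup>2 / N + (\<Sum>j\<le>m. (norm (coeff Q j *v x - g j))\<^sup>2)"
      by (rule sum_norm_pythagoras) (use norm_g in \<open>simp add: power2_norm_eq_inner\<close>)
    then have "sqrt ((norm r)\<^sup>2 / N) \<le> sqrt (\<Sum>j\<le>m. (norm (coeff Q j *v x))\<^sup>2)"
      by (intro real_sqrt_le_mono) (simp add: sum_nonneg)
    then show "norm r / sqrt N \<le> mpnorm M m Q"
      using mpnorm_ge[of Q M] by (simp add: real_sqrt_divide)
  qed
  show "norm r / sqrt N \<le> e"
    if "e \<in> {mpnorm M m Q |Q. Q \<in> mpoly_space m \<and> mpeval P lam *v x + mpeval Q lam *v x = 0}" for e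
    using that lower by blast
  \<comment> \<open>The matrix \<open>outer (g j) y\<close> maps the unit vector \<open>x\<close> to
    \<open>g j\<close> and has norm at most \<open>norm (g j)\<close>.\<close>
  let ?Q = "mpoly_of m (\<lambda>j. outer (g j) y)"
  have "(\<Sum>j\<le>m. lam ^ j *s g j) = (\<Sum>j\<le>m. (lam ^ j * cnj (lam ^ j) / of_real N) *s r)"
    by (simp add: g_def)
  also have "\<dots> = r"
    unfolding sum_scalar_mult sum_divide_distrib[symmetric] sum_Lam using N by simp
  finally have Q: "mpeval P lam *v x + mpeval ?Q lam *v x = 0"
    by (simp add: mpeval_mpoly_space[OF mpoly_of_in_mpoly_space] coeff_mpoly_of sum_mult_vector
        mscale_mult_vector outer_mult_vector tdot_cnj_unit assms)
  have "mpnorm M m ?Q \<le> sqrt (\<Sum>j\<le>m. (norm (g j))\<^sup>2)"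
    unfolding mpnorm_def
  proof (intro real_sqrt_le_mono sum_mono power_mono)
    show "matnorm M (coeff ?Q j) \<le> norm (g j)" if "j \<in> {..m}" for j
      using matnorm_outer_le[of M "g j" y] that x by (simp add: coeff_mpoly_of)
  qed (rule matnorm_nonneg)
  then have "mpnorm M m ?Q = norm r / sqrt N"
    using lower[OF mpoly_of_in_mpoly_space Q, of M] by (simp add: norm_g real_sqrt_divide)
  then show "norm r / sqrt N
      \<in> {mpnorm M m Q |Q. Q \<in> mpoly_space m \<and> mpeval P lam *v x + mpeval Q lam *v x = 0}"
    using mpoly_of_in_mpoly_space Q by force
qed

end

text \<open>All entries have modulus 1, and exactly half of the indices from 0 to an odd
  \<open>m\<close> are odd.\<close>

lemma vnorm_unit_circle:
  assumes "odd m" "cmod lam = 1"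
  shows "(vnorm m (Lam lam))\<^sup>2 = 2 * (vnorm m (odd_proj (Lam lam)))\<^sup>2"
proof -
  obtain k where "m = Suc (2 * k)"
    using assms(1) by (auto elim: oddE)
  moreover have "(\<Sum>j\<le>Suc (2 * k). (cmod (Lam lam j))\<^sup>2)
      = 2 * (\<Sum>j\<le>Suc (2 * k). (cmod (odd_proj (Lam lam) j))\<^sup>2)"
    by (induction k) (simp_all add: Lam_def odd_proj_def even_proj_def norm_mult norm_power assms(2))
  ultimately show ?thesis
    by (simp add: vnorm_square)
qed

(* The norm type M is arbitrary in the unstructured backward error, since the latter has the
   same value for both norms. In the case of odd m and |lambda| = 1, the equality of structured
   and unstructured backward error for the spectral norm holds only under the condition x^T r = 0:
   for P(z) = z with n = m = lambda = 1 and x = 1 the structured error is 1, while the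
   unstructured error is 1 / sqrt 2. *)
theorem theorem3p10:
  fixes m :: nat and P :: "'n::finite mpoly" and lam :: complex and x r :: "complex ^ 'n"
    and M :: norm_type
  assumes "m \<ge> 1" and "P \<in> T_odd m" and "regular_mpoly P" and "hdot x x = 1"
    and r: "r = - (mpeval P lam *v x)"
  shows
    "structured_backward_err (T_odd m) Fro m lam x P =
       (if lam \<noteq> 0 then
          sqrt ((cmod (tdot x r))\<^sup>2 / (vnorm m (odd_proj (Lam lam)))\<^sup>2
                + 2 * (((norm r)\<^sup>2 - (cmod (tdot x r))\<^sup>2) / (vnorm m (Lam lam))\<^sup>2))
        else sqrt 2 * backward_err M m lam x P)
     \<and> structured_backward_err (T_odd m) Two m lam x P =
       (if lam \<noteq> 0 then
          sqrt ((cmod (tdot x r))\<^sup>2 / (vnorm m (odd_proj (Lam lam)))\<^sup>2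
                + ((norm r)\<^sup>2 - (cmod (tdot x r))\<^sup>2) / (vnorm m (Lam lam))\<^sup>2)
        else backward_err M m lam x P)
     \<and> (odd m \<and> cmod lam = 1 \<longrightarrow>
          structured_backward_err (T_odd m) Fro m lam x P = sqrt 2 * backward_err M m lam x P
          \<and> (structured_backward_err (T_odd m) Two m lam x P = backward_err M m lam x P
               \<longleftrightarrow> tdot x r = 0))
     \<and> (let \<Delta>P = mpoly_of m (Fcoeff m lam x r) in
          \<Delta>P \<in> T_odd m
          \<and> mpeval P lam *v x + mpeval \<Delta>P lam *v x = 0
          \<and> mpnorm Fro m \<Delta>P = structured_backward_err (T_odd m) Fro m lam x P
          \<and> (\<forall>Q \<in> T_odd m. mpeval P lam *v x + mpeval Q lam *v x = 0
                \<and> mpnorm Fro m Q = structured_backward_err (T_odd m) Fro m lam x P \<longrightarrow> Q = \<Delta>P))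
     \<and> (let \<Delta>P = mpoly_of m (Acoeff m lam x r) in
          \<Delta>P \<in> T_odd m
          \<and> mpeval P lam *v x + mpeval \<Delta>P lam *v x = 0
          \<and> mpnorm Two m \<Delta>P = structured_backward_err (T_odd m) Two m lam x P)"
proof -
  define s where "s = tdot x r"
  define N where "N = (vnorm m (Lam lam))\<^sup>2"
  define K where "K = (vnorm m (odd_proj (Lam lam)))\<^sup>2"
  have x: "norm x = 1"
  proof -
    have "(norm x)\<^sup>2 = 1"
      using assms(4) unfolding hdot_self by (simp only: of_real_eq_1_iff)
    then show ?thesis
      by (metis norm_ge_zero one_power2 power2_eq_imp_eq zero_le_one)
  qed
  \<comment> \<open>At \<open>lam = 0\<close> the T-odd condition makes \<open>mpeval P lam\<close>
    skew-symmetric. This justifies reading the quotient by \<open>K = 0\<close> as zero.\<close>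
  have s0: "s = 0" if "lam = 0"
  proof -
    have "transpose (mpeval P lam) = - mpeval P lam"
      using assms(2) that unfolding T_odd_def by (metis (mono_tags, lifting) mem_Collect_eq minus_zero)
    then show ?thesis
      unfolding s_def r by (simp add: tdot_right tdot_skew)
  qed
  have K0: "lam = 0" if "K = 0"
    using vnorm_odd_Lam_pos[OF assms(1), of lam] that unfolding K_def by fastforce
  have Ks: "(vnorm m (odd_proj (Lam lam)))\<^sup>2 = 0 \<longrightarrow> tdot x r = 0"
    using K0 s0 unfolding K_def s_def by blast
  have N: "N > 0"
    unfolding N_def by (rule vnorm_Lam_pos)
  note fro = structured_backward_err_Fro[OF x r Ks, folded s_def N_def K_def]
  note two = structured_backward_err_Two[OF x r Ks, folded s_def N_def K_def]
  note unstructured = backward_err_eq[OF x r, of M m, folded N_def]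
  have circle: "structured_backward_err (T_odd m) Fro m lam x P = sqrt 2 * backward_err M m lam x P
      \<and> (structured_backward_err (T_odd m) Two m lam x P = backward_err M m lam x P \<longleftrightarrow> s = 0)"
    if "odd m" "cmod lam = 1"
  proof
    have K: "N = 2 * K"
      unfolding N_def K_def using that by (rule vnorm_unit_circle)
    have "(cmod s)\<^sup>2 / K + 2 * ((norm r)\<^sup>2 - (cmod s)\<^sup>2) / N = 2 * ((norm r)\<^sup>2 / N)"
      using N unfolding K by (simp add: field_simps)
    then show "structured_backward_err (T_odd m) Fro m lam x P = sqrt 2 * backward_err M m lam x P"
      unfolding fro unstructured by (simp only: real_sqrt_mult real_sqrt_divide) simp
    \<comment> \<open>With \<open>N = 2 * K\<close>, the term in \<open>s\<close> cancels in the
      Frobenius case, but here it survives with weight \<open>1 / N\<close>.\<close>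
    have err: "(cmod s)\<^sup>2 / K + ((norm r)\<^sup>2 - (cmod s)\<^sup>2) / N = ((norm r)\<^sup>2 + (cmod s)\<^sup>2) / N"
      using N unfolding K by (simp add: field_simps)
    have eta: "norm r / sqrt N = sqrt ((norm r)\<^sup>2 / N)"
      by (simp add: real_sqrt_divide)
    show "structured_backward_err (T_odd m) Two m lam x P = backward_err M m lam x P
        \<longleftrightarrow> s = 0"
      unfolding two unstructured err eta real_sqrt_eq_iff using N by simp
  qed
  have F: "mpoly_of m (Fcoeff m lam x r) \<in> T_odd m
      \<and> mpeval P lam *v x + mpeval (mpoly_of m (Fcoeff m lam x r)) lam *v x = 0"
    and A: "mpoly_of m (Acoeff m lam x r) \<in> T_odd m
      \<and> mpeval P lam *v x + mpeval (mpoly_of m (Acoeff m lam x r)) lam *v x = 0"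
    unfolding T_odd_constraint_iff[OF x r] odd_feasible_coeff_mpoly_of[OF x]
    using mpoly_of_in_mpoly_space Fcoeff_feasible[OF x Ks] Acoeff_feasible[OF x Ks] by blast+
  have zero: "structured_backward_err (T_odd m) Fro m lam x P = sqrt 2 * backward_err M m lam x P
      \<and> structured_backward_err (T_odd m) Two m lam x P = backward_err M m lam x P" if "lam = 0"
    unfolding fro two unstructured s0[OF that] by (simp add: real_sqrt_divide real_sqrt_mult)
  have "structured_backward_err (T_odd m) Fro m lam x P =
      (if lam \<noteq> 0 then sqrt ((cmod s)\<^sup>2 / K + 2 * (((norm r)\<^sup>2 - (cmod s)\<^sup>2) / N))
       else sqrt 2 * backward_err M m lam x P)"
    using zero fro by (metis times_divide_eq_right)
  moreover have "structured_backward_err (T_odd m) Two m lam x P =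
      (if lam \<noteq> 0 then sqrt ((cmod s)\<^sup>2 / K + ((norm r)\<^sup>2 - (cmod s)\<^sup>2) / N)
       else backward_err M m lam x P)"
    using zero two by metis
  moreover have "mpnorm Fro m (mpoly_of m (Fcoeff m lam x r))
      = structured_backward_err (T_odd m) Fro m lam x P"
    using mpnorm_Fro_Fcoeff[OF x Ks] unfolding fro s_def N_def K_def .
  moreover have "mpnorm Two m (mpoly_of m (Acoeff m lam x r))
      = structured_backward_err (T_odd m) Two m lam x P"
    using mpnorm_Two_Acoeff[OF x Ks] unfolding two s_def N_def K_def .
  ultimately show ?thesis
    unfolding Let_def s_def[symmetric] N_def[symmetric] K_def[symmetric]
    using circle F A Fro_minimizer_unique[OF x r Ks] by blast
qed

end
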